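(* Fix an integer $k\ge 2$. There are infinitely many positive integers $N$ such that the open interval $(N^k,(N+1)^k)$ contains at least $M$ $k$-full integers, where $$M\ge\sqrt{\Big(\frac{k}{2(k+1)}+o(1)\Big)\frac{\log N}{\log\log N}}$$ with $o(1)\to 0$ as $N\to\infty$.
   Context: A positive integer $n$ is $k$-full if for every prime $q$ dividing $n$ also $q^k$ divides $n$. *)

theory Defs
  imports Complex_Main "HOL-Computational_Algebra.Primes"
begin

definition k_full :: "nat \<Rightarrow> nat \<Rightarrow> bool" where
  "k_full k n \<longleftrightarrow> n > 0 \<and> (\<forall>q. prime q \<longrightarrow> q dvd n \<longrightarrow> q ^ k dvd n)"

end

theory Submission
  imports Defs "HOL-Computational_Algebra.Squarefree"
    "HOL-Analysis.Kronecker_Approximation_Theorem"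
begin

text \<open>
  For squarefree \<open>b > 1\<close> put \<open>\<beta> = b powr (1 + 1/k)\<close>, so that \<open>a^k * b^(k+1) = (a * \<beta>)^k\<close> is
  \<open>k\<close>-full and never a perfect \<open>k\<close>-th power. Dirichlet's simultaneous approximation theorem,
  applied to the numbers \<open>1/\<beta>\<close> for \<open>2 * M\<close> values of \<open>b\<close> of size \<open>O(M^2)\<close>, gives an integer
  \<open>Q\<close> with \<open>\<bar>Q - a * \<beta>\<bar> < 1\<close> for a suitable \<open>a\<close> depending on \<open>b\<close>. Each of the \<open>2 * M\<close>
  resulting \<open>k\<close>-full numbers lies strictly between the \<open>k\<close>-th powers of \<open>Q - 1\<close> and \<open>Q\<close>, or of
  \<open>Q\<close> and \<open>Q + 1\<close>, so one of these two intervals contains \<open>M\<close> of them. As \<open>ln Q = O(M * ln M)\<close>,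
  this is more than the claimed bound, and \<open>\<epsilon> = 0\<close> can be chosen.
\<close>

lemma k_full_power_mult_power_Suc:
  assumes "a > 0" "b > 0"
  shows "k_full k (a ^ k * b ^ (k + 1))"
  unfolding k_full_def
proof (intro conjI allI impI)
  show "a ^ k * b ^ (k + 1) > 0"
    using assms by simp
  fix q :: nat
  assume q: "prime q" "q dvd a ^ k * b ^ (k + 1)"
  then have "q dvd a \<or> q dvd b"
    by (meson prime_dvd_mult_iff prime_dvd_power)
  then show "q ^ k dvd a ^ k * b ^ (k + 1)"
    by (auto intro: dvd_mult dvd_mult2 dvd_power_same)
qed

text \<open>The multiplicity of a prime in \<open>a ^ k * b ^ (k + 1)\<close> is congruent modulo
  \<open>k\<close> to its multiplicity in \<open>b\<close>. For squarefree \<open>b\<close> the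
  latter is 0 or 1, so it is determined by its residue because \<open>k \<ge> 2\<close>. The case
  \<open>d = 1\<close> shows that perfect \<open>k\<close>-th powers arise only from
  \<open>b = 1\<close>.\<close>

lemma squarefree_power_mult_power_Suc_inj:
  fixes a b c d k :: nat
  assumes k: "k \<ge> 2" and pos: "a > 0" "c > 0" and sf: "squarefree b" "squarefree d"
    and eq: "a ^ k * b ^ (k + 1) = c ^ k * d ^ (k + 1)"
  shows "b = d"
proof (rule multiplicity_eq_nat)
  have nz: "b \<noteq> 0" "d \<noteq> 0"
    using sf by (metis not_squarefree_0)+
  then show "b > 0" "d > 0"
    by auto
  fix p :: nat
  assume p: "prime p"
  let ?v = "\<lambda>n. int (multiplicity p n)"
  have mult: "multiplicity p (x ^ k * y ^ (k + 1)) = k * multiplicity p x + (k + 1) * multiplicity p y"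
    if "x \<noteq> 0" "y \<noteq> 0" for x y
    using that p
    by (simp add: prime_elem_multiplicity_mult_distrib prime_elem_multiplicity_power_distrib
        del: power_Suc)
  have "k * multiplicity p a + (k + 1) * multiplicity p b
      = k * multiplicity p c + (k + 1) * multiplicity p d"
    using mult[of a b] mult[of c d] eq pos nz by simp
  then have "int (k * multiplicity p a + (k + 1) * multiplicity p b)
      = int (k * multiplicity p c + (k + 1) * multiplicity p d)"
    by simp
  then have "?v b - ?v d = int k * (?v c + ?v d - ?v a - ?v b)"
    by (simp add: algebra_simps)
  then have "int k dvd ?v b - ?v d"
    by simp
  moreover have "multiplicity p b \<le> 1" "multiplicity p d \<le> 1"
    using sf nz p squarefree_factorial_semiring'' by metis+
  then have "\<bar>?v b - ?v d\<bar> < int k"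
    using k by linarith
  ultimately have "?v b - ?v d = 0"
    by (metis dvd_imp_le_int abs_of_nat linorder_not_le)
  then show "multiplicity p b = multiplicity p d"
    by simp
qed

text \<open>Each positive \<open>n \<le> m ^ 2\<close> is a squarefree number times a square whose
  root is at most \<open>m\<close>. Counting these pairs gives
  \<open>m ^ 2 \<le> card ?S * m\<close>, a crude but elementary substitute for the density of the
  squarefree numbers.\<close>

lemma card_squarefree_ge:
  "card {b :: nat. squarefree b \<and> b \<le> m ^ 2} \<ge> m"
proof (cases "m = 0")
  case False
  let ?S = "{b :: nat. squarefree b \<and> b \<le> m ^ 2}"
  let ?f = "\<lambda>n :: nat. (squarefree_part n, square_part n)"
  have fin: "finite ?S"
    by (rule finite_subset[of _ "{..m ^ 2}"]) auto
  have "inj_on ?f {1..m ^ 2}"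
    by (rule inj_onI) (metis prod.inject squarefree_decompose)
  moreover have "?f ` {1..m ^ 2} \<subseteq> ?S \<times> {1..m}"
  proof clarify
    fix n :: nat
    assume n: "n \<in> {1..m ^ 2}"
    then have "square_part n > 0"
      by (auto intro!: Nat.gr0I)
    moreover have "squarefree_part n dvd n" "square_part n ^ 2 dvd n"
      by (metis dvd_triv_left squarefree_decompose, rule square_part_square_dvd)
    then have "squarefree_part n \<le> m ^ 2" "square_part n ^ 2 \<le> m ^ 2"
      using n by (meson atLeastAtMost_iff dvd_imp_le less_le_trans order_trans zero_less_one)+
    ultimately show "squarefree_part n \<in> ?S \<and> square_part n \<in> {1..m}"
      by (auto simp: power2_nat_le_eq_le)
  qed
  ultimately have "card {1..m ^ 2} \<le> card (?S \<times> {1..m})"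
    using fin by (intro card_inj_on_le[of ?f]) auto
  then have "m * m \<le> card ?S * m"
    by (simp add: card_cartesian_product power2_eq_square)
  then show ?thesis
    using False by simp
qed auto

lemma simultaneous_near_power:
  fixes B :: "nat set" and k D :: nat
  assumes "finite B" and k: "k > 0" and D: "D > 0" and B: "\<And>b. b \<in> B \<Longrightarrow> b > 0 \<and> b \<le> D"
  obtains Q :: nat and a :: "nat \<Rightarrow> nat"
  where "Q > 0" "Q \<le> (D ^ 2) ^ card B"
    "\<And>b. b \<in> B \<Longrightarrow> a b > 0"
    "\<And>b. b \<in> B \<Longrightarrow> (Q - 1) ^ k < a b ^ k * b ^ (k + 1)"
    "\<And>b. b \<in> B \<Longrightarrow> a b ^ k * b ^ (k + 1) < (Q + 1) ^ k"
proof -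
  define \<beta> where "\<beta> b = real b * root k (real b)" for b :: nat
  have \<beta>_pow: "\<beta> b ^ k = real b ^ (k + 1)" for b
    using k by (simp add: \<beta>_def power_mult_distrib)
  have \<beta>: "\<beta> b > 0" "\<beta> b \<le> real (D ^ 2)" if "b \<in> B" for b
  proof -
    have b: "real b \<ge> 1" "real b \<le> real D"
      using B[OF that] by auto
    then show "\<beta> b > 0"
      using k by (simp add: \<beta>_def)
    \<comment> \<open>Bounding the root of \<open>b\<close> by \<open>b\<close> itself gives one
      bound \<open>D ^ 2\<close> that serves all \<open>b\<close> in \<open>B\<close> and does not
      depend on \<open>k\<close>.\<close>
    have "root k (real b) \<le> root k (real b ^ k)"
      using b k self_le_power[of "real b" k] by simp
    also have "\<dots> = real b"
      using b k by (simp add: real_root_power_cancel)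
    finally have "\<beta> b \<le> real b * real b"
      by (simp add: \<beta>_def mult_left_mono)
    also have "\<dots> \<le> real D * real D"
      using b by (intro mult_mono) auto
    finally show "\<beta> b \<le> real (D ^ 2)"
      by (simp add: power2_eq_square)
  qed
  obtain e where e: "bij_betw e {..<card B} B"
    using ex_bij_betw_nat_finite[OF \<open>finite B\<close>] by (auto simp: atLeast0LessThan)
  have D2: "D ^ 2 > 0"
    using D by simp
  \<comment> \<open>The accuracy \<open>1 / D ^ 2\<close> is at most \<open>1 / \<beta> b\<close>
    for every \<open>b\<close> in \<open>B\<close>, so the error is still below 1 after
    multiplication by \<open>\<beta> b\<close>.\<close>
  obtain q p where q: "0 < q" "q \<le> int ((D ^ 2) ^ card B)"
    and p: "\<And>i. i < card B \<Longrightarrow> \<bar>of_int q * (1 / \<beta> (e i)) - of_int (p i)\<bar> < 1 / real (D ^ 2)"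
    using Dirichlet_approx_simult[OF D2, where n = "card B" and \<theta> = "\<lambda>i. 1 / \<beta> (e i)"] by metis
  define Q where "Q = nat q"
  have Q: "Q > 0" "Q \<le> (D ^ 2) ^ card B" "real_of_int q = real Q"
    using q by (auto simp: Q_def nat_le_iff)
  have "\<exists>a :: nat. a > 0 \<and> (Q - 1) ^ k < a ^ k * b ^ (k + 1) \<and> a ^ k * b ^ (k + 1) < (Q + 1) ^ k"
    if b: "b \<in> B" for b
  proof -
    have "b \<in> e ` {..<card B}"
      using b bij_betw_imp_surj_on[OF e] by simp
    then obtain i where i: "i < card B" "e i = b"
      by blast
    define z where "z = p i"
    have "\<bar>real Q / \<beta> b - real_of_int z\<bar> < 1 / real (D ^ 2)"
      using p[OF i(1)] i(2) Q(3) by (simp add: z_def)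
    also have "\<dots> \<le> 1 / \<beta> b"
      using \<beta>[OF b] D by (intro divide_left_mono mult_pos_pos) auto
    finally have "\<bar>real Q / \<beta> b - real_of_int z\<bar> * \<beta> b < 1 / \<beta> b * \<beta> b"
      using \<beta>(1)[OF b] by (intro mult_strict_right_mono)
    moreover have "\<bar>real Q / \<beta> b - real_of_int z\<bar> * \<beta> b = \<bar>(real Q / \<beta> b - real_of_int z) * \<beta> b\<bar>"
      using \<beta>(1)[OF b] by (simp add: abs_mult)
    moreover have "(real Q / \<beta> b - real_of_int z) * \<beta> b = real Q - real_of_int z * \<beta> b"
      using \<beta>(1)[OF b] by (simp add: algebra_simps)
    ultimately have close: "\<bar>real Q - real_of_int z * \<beta> b\<bar> < 1"
      using \<beta>(1)[OF b] by simp
    \<comment> \<open>A number at distance less than 1 from \<open>Q \<ge> 1\<close> is positive, so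
      the numerator \<open>z\<close> is a positive integer and can serve as
      \<open>a\<close>.\<close>
    then have "real_of_int z * \<beta> b > 0"
      using Q(1) by linarith
    then have "z > 0"
      using \<beta>(1)[OF b] by (simp add: zero_less_mult_iff)
    define a where "a = nat z"
    have a: "a > 0" "real_of_int z = real a"
      using \<open>z > 0\<close> by (auto simp: a_def)
    have pow: "(real a * \<beta> b) ^ k = real (a ^ k * b ^ (k + 1))"
      using \<beta>_pow[of b] by (simp add: power_mult_distrib)
    have "real (Q - 1) < real a * \<beta> b" "real a * \<beta> b < real (Q + 1)"
      using close a Q(1) by (auto simp: of_nat_diff)
    then have "real (Q - 1) ^ k < (real a * \<beta> b) ^ k" "(real a * \<beta> b) ^ k < real (Q + 1) ^ k"
      using k \<beta>(1)[OF b] by (auto intro!: power_strict_mono)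
    then have "real ((Q - 1) ^ k) < real (a ^ k * b ^ (k + 1))"
      "real (a ^ k * b ^ (k + 1)) < real ((Q + 1) ^ k)"
      unfolding pow of_nat_power by auto
    then show ?thesis
      using a(1) unfolding of_nat_less_iff by blast
  qed
  then obtain a where "\<And>b. b \<in> B \<Longrightarrow> a b > 0 \<and> (Q - 1) ^ k < a b ^ k * b ^ (k + 1) \<and>
      a b ^ k * b ^ (k + 1) < (Q + 1) ^ k"
    by metis
  then show thesis
    using that[of Q a] Q by blast
qed

lemma many_k_full_between_powers:
  fixes k M :: nat
  assumes k: "k \<ge> 2" and M: "M > 0"
  obtains N :: nat
  where "N \<le> (2 * M + 1) ^ (8 * M)"
    "M \<le> card {n. n \<in> {N ^ k <..< (N + 1) ^ k} \<and> k_full k n}"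
proof -
  \<comment> \<open>There are at least \<open>2 * M + 1\<close> squarefree numbers up to this
    \<open>D\<close>. One is spent on discarding \<open>b = 1\<close>, which yields only perfect
    \<open>k\<close>-th powers.\<close>
  define D where "D = (2 * M + 1) ^ 2"
  let ?S = "{b :: nat. squarefree b \<and> b \<le> D}"
  have "finite ?S"
    by (rule finite_subset[of _ "{..D}"]) auto
  then have "2 * M \<le> card (?S - {1})"
    using card_squarefree_ge[of "2 * M + 1"] by (simp add: D_def card_Diff_singleton_if)
  then obtain B where B: "B \<subseteq> ?S - {1}" "card B = 2 * M" "finite B"
    by (rule obtain_subset_with_card_n)
  have sf: "squarefree b" "b \<noteq> 1" "b > 0" "b \<le> D" if "b \<in> B" for b
    using B(1) that by (auto intro!: Nat.gr0I)
  have Dpos: "D > 0" and kpos: "k > 0"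
    using k by (auto simp: D_def)
  obtain Q a where Q: "Q > 0" "Q \<le> (D ^ 2) ^ card B"
    and a: "\<And>b. b \<in> B \<Longrightarrow> a b > 0"
    and lower: "\<And>b. b \<in> B \<Longrightarrow> (Q - 1) ^ k < a b ^ k * b ^ (k + 1)"
    and upper: "\<And>b. b \<in> B \<Longrightarrow> a b ^ k * b ^ (k + 1) < (Q + 1) ^ k"
    using simultaneous_near_power[OF B(3) kpos Dpos, of thesis] sf by blast
  define f where "f b = a b ^ k * b ^ (k + 1)" for b
  define F where "F N = {n. n \<in> {N ^ k <..< (N + 1) ^ k} \<and> k_full k n}" for N
  have fin: "finite (F N)" for N
    by (rule finite_subset[of _ "{N ^ k <..< (N + 1) ^ k}"]) (auto simp: F_def)
  have "inj_on f B"
  proof (rule inj_onI)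
    fix b d
    assume "b \<in> B" "d \<in> B" "f b = f d"
    then show "b = d"
      using squarefree_power_mult_power_Suc_inj[OF k a a sf(1) sf(1)] unfolding f_def by blast
  qed
  have "f ` B \<subseteq> F (Q - 1) \<union> F Q"
  proof
    fix n
    assume "n \<in> f ` B"
    then obtain b where b: "b \<in> B" "n = f b"
      by blast
    \<comment> \<open>Writing \<open>Q ^ k\<close> as \<open>Q ^ k * 1 ^ (k + 1)\<close>, equality
      would force \<open>b = 1\<close>.\<close>
    have "f b \<noteq> Q ^ k"
      using squarefree_power_mult_power_Suc_inj[OF k a[OF b(1)] Q(1) sf(1)[OF b(1)] squarefree_1]
        sf(2)[OF b(1)] by (auto simp: f_def)
    moreover have "k_full k (f b)"
      unfolding f_def by (rule k_full_power_mult_power_Suc[OF a[OF b(1)] sf(3)[OF b(1)]])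
    moreover have "(Q - 1) ^ k < f b" "f b < (Q + 1) ^ k"
      unfolding f_def by (rule lower[OF b(1)], rule upper[OF b(1)])
    moreover have "Q - 1 + 1 = Q"
      using Q(1) by simp
    ultimately show "n \<in> F (Q - 1) \<union> F Q"
      unfolding F_def b(2) by (cases "f b" "Q ^ k" rule: linorder_cases) simp_all
  qed
  then have "card (f ` B) \<le> card (F (Q - 1) \<union> F Q)"
    using fin by (intro card_mono) auto
  also have "\<dots> \<le> card (F (Q - 1)) + card (F Q)"
    by (rule card_Un_le)
  \<comment> \<open>Pigeonhole: \<open>2 * M\<close> distinct values are shared between two
    intervals.\<close>
  finally have "M \<le> card (F (Q - 1)) \<or> M \<le> card (F Q)"
    using card_image[OF \<open>inj_on f B\<close>] B(2) by linarith
  moreover have "(D ^ 2) ^ card B = (2 * M + 1) ^ (8 * M)"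
    by (simp add: D_def B(2) flip: power_mult)
  then have "Q \<le> (2 * M + 1) ^ (8 * M)" "Q - 1 \<le> (2 * M + 1) ^ (8 * M)"
    using Q(2) by linarith+
  ultimately show thesis
    using that[of "Q - 1"] that[of Q] unfolding F_def by blast
qed

theorem theoremA1:
  fixes k :: nat
  assumes "k \<ge> 2"
  shows "\<exists>\<epsilon> :: nat \<Rightarrow> real. \<epsilon> \<longlonglongrightarrow> 0 \<and>
    infinite {N :: nat. N > 0 \<and>
      (\<exists>M :: nat. M \<le> card {n :: nat. n \<in> {N ^ k <..< (N + 1) ^ k} \<and> k_full k n} \<and>
        real M \<ge> sqrt ((real k / (2 * (real k + 1)) + \<epsilon> N) * (ln (real N) / ln (ln (real N)))))}"
proof (intro exI[of _ "\<lambda>_. 0"] conjI)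
  show "infinite {N :: nat. N > 0 \<and>
      (\<exists>M :: nat. M \<le> card {n :: nat. n \<in> {N ^ k <..< (N + 1) ^ k} \<and> k_full k n} \<and>
        real M \<ge> sqrt ((real k / (2 * (real k + 1)) + 0) * (ln (real N) / ln (ln (real N)))))}"
    unfolding infinite_nat_iff_unbounded
  proof
    fix m :: nat
    \<comment> \<open>Once \<open>N > c\<close>, both \<open>N > m\<close> and
      \<open>ln (ln N) \<ge> 1\<close> follow.\<close>
    define c where "c = m + nat \<lceil>exp (exp 1 :: real)\<rceil>"
    \<comment> \<open>The left side will bound \<open>ln N\<close>. The constant 2 on the right
      cancels the factor 1/2 that bounds \<open>k / (2 * (k + 1))\<close>, leaving exactly
      \<open>M ^ 2\<close> under the root.\<close>
    have "eventually (\<lambda>M :: nat. 8 * real M * ln (2 * real M + 1) \<le> 2 * real M ^ 2) at_top"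
      by real_asymp
    moreover have "eventually (\<lambda>M. M > (c + 1) ^ k) at_top"
      by (rule eventually_gt_at_top)
    ultimately obtain M :: nat where M: "8 * real M * ln (2 * real M + 1) \<le> 2 * real M ^ 2"
      "M > (c + 1) ^ k"
      using eventually_happens[OF eventually_conj] by fastforce
    have "M > 0"
      using M(2) by simp
    then obtain N where N: "N \<le> (2 * M + 1) ^ (8 * M)"
      "M \<le> card {n. n \<in> {N ^ k <..< (N + 1) ^ k} \<and> k_full k n}"
      using many_k_full_between_powers[OF assms] by blast
    \<comment> \<open>The construction bounds \<open>N\<close> only from above. It is large all the
      same, since \<open>M > (c + 1) ^ k\<close> integers must fit below
      \<open>(N + 1) ^ k\<close>.\<close>
    have "card {n. n \<in> {N ^ k <..< (N + 1) ^ k} \<and> k_full k n} \<le> card {..<(N + 1) ^ k}"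
      by (intro card_mono) auto
    then have "(c + 1) ^ k < (N + 1) ^ k"
      using N(2) M(2) by simp
    then have "c < N"
      using power_less_imp_less_base[of "c + 1" k "N + 1"] by simp
    then have "N > m" "exp (exp 1) \<le> real N"
      unfolding c_def by linarith+
    have "N > 0"
      using \<open>c < N\<close> by simp
    have "exp 1 \<le> ln (real N)"
      using \<open>exp (exp 1) \<le> real N\<close> \<open>N > 0\<close> by (simp add: ln_ge_iff)
    then have lnN: "ln (real N) > 0"
      using exp_gt_zero[of "1 :: real"] by linarith
    then have lnln: "ln (ln (real N)) \<ge> 1"
      using \<open>exp 1 \<le> ln (real N)\<close> by (simp add: ln_ge_iff)
    have "real N \<le> real ((2 * M + 1) ^ (8 * M))"
      using N(1) by (rule of_nat_mono)
    also have "\<dots> = (2 * real M + 1) ^ (8 * M)"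
      unfolding of_nat_power by (simp add: add.commute)
    finally have "ln (real N) \<le> ln ((2 * real M + 1) ^ (8 * M))"
      using \<open>N > 0\<close> by (intro ln_mono) auto
    also have "\<dots> = 8 * real M * ln (2 * real M + 1)"
      by (simp add: ln_realpow)
    also have "\<dots> \<le> 2 * real M ^ 2"
      by (rule M(1))
    finally have "ln (real N) \<le> 2 * real M ^ 2" .
    moreover have "ln (real N) / ln (ln (real N)) \<le> ln (real N) / 1"
      using lnN lnln by (intro divide_left_mono) linarith+
    ultimately have quot: "ln (real N) / ln (ln (real N)) \<le> 2 * real M ^ 2"
      by simp
    have "real k / (2 * (real k + 1)) + 0 \<le> 1 / 2"
      by (simp add: field_simps)
    moreover have "ln (real N) / ln (ln (real N)) \<ge> 0"
      using lnN lnln by (intro divide_nonneg_nonneg) linarith+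
    ultimately have "(real k / (2 * (real k + 1)) + 0) * (ln (real N) / ln (ln (real N)))
        \<le> 1 / 2 * (2 * real M ^ 2)"
      using quot by (intro mult_mono) auto
    then have "sqrt ((real k / (2 * (real k + 1)) + 0) * (ln (real N) / ln (ln (real N)))) \<le> real M"
      by (intro real_le_lsqrt) auto
    then show "\<exists>n>m. n \<in> {N :: nat. N > 0 \<and>
      (\<exists>M :: nat. M \<le> card {n :: nat. n \<in> {N ^ k <..< (N + 1) ^ k} \<and> k_full k n} \<and>
        real M \<ge> sqrt ((real k / (2 * (real k + 1)) + 0) * (ln (real N) / ln (ln (real N)))))}"
      using \<open>N > m\<close> \<open>N > 0\<close> N(2) by blast
  qed
qed simp

end
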